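(* Let $\mathbf{B}(x,\lambda)$ be a real symmetric $4\times4$ matrix depending smoothly on $(x,\lambda)\in\mathbb{R}^2$, let $\mathbf{A}(x,\lambda)=\mathbf{J}^{-1}\mathbf{B}(x,\lambda)$, and assume that $\mathbf{A}_\infty(\lambda)=\lim_{x\to\pm\infty}\mathbf{A}(x,\lambda)$ exists (the same limit at both ends). Fix $\lambda\in\mathbb{R}$ such that $\mathbf{A}_\infty(\lambda)$ has no purely imaginary eigenvalues, and let $\sigma_+=\sigma_+(\lambda)$ be the sum of the eigenvalues of $\mathbf{A}_\infty(\lambda)$ with positive real part. Let $L>0$ and let $\widehat{\mathbf{U}}^+:[-L,L]\to\bigwedge^2(\mathbb{R}^4)$ be any solution of $$\frac{d}{dx}\widehat{\mathbf{U}}^+=\left[\mathbf{A}^{(2)}(x,\lambda)-\sigma_+(\lambda)\mathbf{I}\right]\widehat{\mathbf{U}}^+ .$$ Then $\sigma_+$ is real and positive and, for all $x\in[-L,L]$, $$\left(\widehat{\mathbf{U}}^+\wedge\widehat{\mathbf{U}}^+\right)(x)=e^{-2\sigma_+(x+L)}\left(\widehat{\mathbf{U}}^+\wedge\widehat{\mathbf{U}}^+\right)(-L),\qquad \boldsymbol{\omega}\wedge\widehat{\mathbf{U}}^+(x)=e^{-\sigma_+(x+L)}\,\boldsymbol{\omega}\wedge\widehat{\mathbf{U}}^+(-L).$$ Thus both quantities, whose vanishing defines the Lagrangian Grassmannian, are exponentially attracted to zero.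
   Context: $\mathbf{J}=\begin{pmatrix}\mathbf{0}&-\mathbf{I}\\ \mathbf{I}&\mathbf{0}\end{pmatrix}$ is the standard symplectic operator on $\mathbb{R}^4$ ($2\times2$ blocks); $\mathbf{e}_1,\dots,\mathbf{e}_4$ is the canonical basis of $\mathbb{R}^4$ and $\boldsymbol{\omega}=\mathbf{e}_1\wedge\mathbf{e}_3+\mathbf{e}_2\wedge\mathbf{e}_4\in\bigwedge^2(\mathbb{R}^4)$. For a $4\times4$ matrix $\mathbf{A}$, $\mathbf{A}^{(2)}$ is the induced linear map on $\bigwedge^2(\mathbb{R}^4)$ determined by $\mathbf{A}^{(2)}(\mathbf{u}\wedge\mathbf{v})=\mathbf{A}\mathbf{u}\wedge\mathbf{v}+\mathbf{u}\wedge\mathbf{A}\mathbf{v}$. Eigenvalues are counted with algebraic multiplicity. The Lagrangian Grassmannian $\Lambda(2)$ is represented by the nonzero $\mathbf{U}\in\bigwedge^2(\mathbb{R}^4)$ with $\mathbf{U}\wedge\mathbf{U}=0$ and $\boldsymbol{\omega}\wedge\mathbf{U}=0$. *)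

theory Defs
  imports
    "HOL-Analysis.Analysis"
    "HOL-Computational_Algebra.Polynomial"
begin

subsection \<open>Smooth maps\<close>

text \<open>
  On a finite-dimensional domain, asking that all directional derivatives
  \<open>x \<mapsto> D f(x) v\<close> are \<open>C\<^sup>k\<close> is the same as asking that \<open>x \<mapsto> D f(x)\<close> is \<open>C\<^sup>k\<close>.
\<close>

primrec C_k :: "nat \<Rightarrow> ('a::euclidean_space \<Rightarrow> 'b::real_normed_vector) \<Rightarrow> bool" where
  "C_k 0 f \<longleftrightarrow> continuous_on UNIV f"
| "C_k (Suc k) f \<longleftrightarrow>
     (\<forall>x. f differentiable (at x)) \<and> (\<forall>v. C_k k (\<lambda>x. frechet_derivative f (at x) v))"

definition smooth :: "('a::euclidean_space \<Rightarrow> 'b::real_normed_vector) \<Rightarrow> bool" where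
  "smooth f \<longleftrightarrow> (\<forall>k. C_k k f)"


subsection \<open>Eigenvalues with algebraic multiplicity\<close>

definition charpoly :: "'a::idom ^ 'n ^ 'n \<Rightarrow> 'a poly" where
  "charpoly M = det (\<chi> i j. (if i = j then [:0, 1:] else 0) - [:M $ i $ j:])"

definition eigenvalues :: "real ^ 'n ^ 'n \<Rightarrow> complex multiset" where
  "eigenvalues M = proots (charpoly (\<chi> i j. complex_of_real (M $ i $ j)))"

lemma poly_charpoly: "poly (charpoly M) z = det (mat z - M)"
  unfolding charpoly_def det_def mat_def
  by (auto simp: poly_sum poly_prod intro!: sum.cong prod.cong)

definition sigma_plus :: "real ^ 'n ^ 'n \<Rightarrow> complex" where
  "sigma_plus M = (\<Sum>\<^sub># {# z \<in># eigenvalues M. 0 < Re z #})"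


subsection \<open>Exterior powers of $R^n$ as alternating tensors\<close>

definition ext2 :: "(real ^ 'n ^ 'n) set" where
  "ext2 = {U. \<forall>i j. U $ i $ j = - U $ j $ i}"

definition wedge11 :: "real ^ 'n \<Rightarrow> real ^ 'n \<Rightarrow> real ^ 'n ^ 'n" (infixl "\<and>\<^sub>1" 70) where
  "u \<and>\<^sub>1 v = (\<chi> i j. u $ i * v $ j - u $ j * v $ i)"

text \<open>
  The product of two bivectors is the sum of their tensor products over the six \<open>(2,2)\<close>-shuffles
  of the indices, so that \<open>(a \<and> b) \<and> (c \<and> d)\<close> is the alternating 4-tensor
  \<open>a \<and> b \<and> c \<and> d\<close>; see \<open>wedge22_wedge11\<close> below.
\<close>

definition wedge22 ::
    "real ^ 'n ^ 'n \<Rightarrow> real ^ 'n ^ 'n \<Rightarrow> real ^ 'n ^ 'n ^ 'n ^ 'n" (infixl "\<and>\<^sub>2" 70) where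
  "U \<and>\<^sub>2 V = (\<chi> i j k l.
       U $ i $ j * V $ k $ l - U $ i $ k * V $ j $ l + U $ i $ l * V $ j $ k
     + U $ j $ k * V $ i $ l - U $ j $ l * V $ i $ k + U $ k $ l * V $ i $ j)"

lemma wedge22_wedge11:
  fixes a b c d :: "real ^ 'n"
  shows "((a \<and>\<^sub>1 b) \<and>\<^sub>2 (c \<and>\<^sub>1 d)) $ i $ j $ k $ l =
    a $ i * det (vector [vector [b $ j, b $ k, b $ l], vector [c $ j, c $ k, c $ l],
                         vector [d $ j, d $ k, d $ l]] :: real ^ 3 ^ 3)
  - a $ j * det (vector [vector [b $ i, b $ k, b $ l], vector [c $ i, c $ k, c $ l],
                         vector [d $ i, d $ k, d $ l]] :: real ^ 3 ^ 3)
  + a $ k * det (vector [vector [b $ i, b $ j, b $ l], vector [c $ i, c $ j, c $ l],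
                         vector [d $ i, d $ j, d $ l]] :: real ^ 3 ^ 3)
  - a $ l * det (vector [vector [b $ i, b $ j, b $ k], vector [c $ i, c $ j, c $ k],
                         vector [d $ i, d $ j, d $ k]] :: real ^ 3 ^ 3)"
  by (simp add: wedge22_def wedge11_def det_3 algebra_simps)

lemma wedge11_in_ext2: "u \<and>\<^sub>1 v \<in> ext2"
  by (simp add: ext2_def wedge11_def)

lemma ext2_eq_sum_wedge11:
  assumes "U \<in> ext2"
  shows "U = (\<Sum>i\<in>UNIV. \<Sum>j\<in>UNIV. (U $ i $ j / 2) *\<^sub>R (axis i 1 \<and>\<^sub>1 axis j 1))"
proof -
  have "(\<Sum>i\<in>UNIV. \<Sum>j\<in>UNIV. (U $ i $ j / 2) *
          (axis i 1 $ k * axis j 1 $ l - axis i 1 $ l * axis j 1 $ k)) = U $ k $ l" for k l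
  proof -
    have "(\<Sum>i\<in>UNIV. \<Sum>j\<in>UNIV. (U $ i $ j / 2) *
          (axis i 1 $ k * axis j 1 $ l - axis i 1 $ l * axis j 1 $ k))
        = (\<Sum>i\<in>UNIV. \<Sum>j\<in>UNIV. if i = k then if j = l then U $ i $ j / 2 else 0 else 0)
        - (\<Sum>i\<in>UNIV. \<Sum>j\<in>UNIV. if i = l then if j = k then U $ i $ j / 2 else 0 else 0)"
      by (simp only: sum_subtractf[symmetric], intro sum.cong refl) (auto simp: axis_def)
    also have "\<dots> = U $ k $ l / 2 - U $ l $ k / 2"
    proof -
      have "(\<Sum>i\<in>UNIV. \<Sum>j\<in>UNIV. if i = k then if j = l then U $ i $ j / 2 else 0 else 0)
          = U $ k $ l / 2" for k l
      proof -
        have "(\<Sum>i\<in>UNIV. \<Sum>j\<in>UNIV. if i = k then if j = l then U $ i $ j / 2 else 0 else 0)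
            = (\<Sum>i\<in>UNIV. if i = k then (\<Sum>j\<in>UNIV. if j = l then U $ i $ j / 2 else 0) else 0)"
          by (intro sum.cong) auto
        then show ?thesis by simp
      qed
      then show ?thesis by (simp only:)
    qed
    also have "\<dots> = U $ k $ l"
    proof -
      have "U $ l $ k = - U $ k $ l" using assms unfolding ext2_def by blast
      then show ?thesis by simp
    qed
    finally show ?thesis .
  qed
  then show ?thesis
    by (simp add: vec_eq_iff wedge11_def sum_component)
qed

text \<open>
  The induced map is only determined on \<open>ext2\<close>, which is spanned by the \<open>u \<and> v\<close>; its
  values outside are irrelevant.
\<close>

definition induced2 :: "real ^ 'n ^ 'n \<Rightarrow> real ^ 'n ^ 'n \<Rightarrow> real ^ 'n ^ 'n" where
  "induced2 A = (SOME F. linear F \<and>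
     (\<forall>u v. F (u \<and>\<^sub>1 v) = (A *v u) \<and>\<^sub>1 v + u \<and>\<^sub>1 (A *v v)))"

lemma linear_induced2: "linear (induced2 A)"
  and induced2_wedge11: "induced2 A (u \<and>\<^sub>1 v) = (A *v u) \<and>\<^sub>1 v + u \<and>\<^sub>1 (A *v v)"
proof -
  let ?P = "\<lambda>F. linear F \<and> (\<forall>u v. F (u \<and>\<^sub>1 v) = (A *v u) \<and>\<^sub>1 v + u \<and>\<^sub>1 (A *v v))"
  have "?P (\<lambda>U. A ** U + U ** transpose A)"
  proof (intro conjI allI)
    show "linear (\<lambda>U. A ** U + U ** transpose A)"
      by (rule linearI)
         (simp_all add: matrix_matrix_mult_def vec_eq_iff sum.distrib sum_distrib_left algebra_simps)
    show "A ** (u \<and>\<^sub>1 v) + (u \<and>\<^sub>1 v) ** transpose A = (A *v u) \<and>\<^sub>1 v + u \<and>\<^sub>1 (A *v v)" for u v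
      by (simp add: matrix_matrix_mult_def matrix_vector_mult_def transpose_def wedge11_def
          vec_eq_iff sum_subtractf sum_distrib_left sum_distrib_right algebra_simps)
  qed
  then have "?P (induced2 A)"
    unfolding induced2_def by (rule someI[of ?P])
  then show "linear (induced2 A)"
    and "induced2 A (u \<and>\<^sub>1 v) = (A *v u) \<and>\<^sub>1 v + u \<and>\<^sub>1 (A *v v)" by auto
qed

lemma induced2_unique:
  assumes "linear F" and "\<And>u v. F (u \<and>\<^sub>1 v) = (A *v u) \<and>\<^sub>1 v + u \<and>\<^sub>1 (A *v v)"
    and "U \<in> ext2"
  shows "induced2 A U = F U"
proof -
  let ?S = "\<Sum>i\<in>UNIV. \<Sum>j\<in>UNIV. (U $ i $ j / 2) *\<^sub>R (axis i 1 \<and>\<^sub>1 axis j 1)"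
  have "induced2 A ?S = F ?S"
    by (simp add: linear_sum[OF assms(1)] linear_sum[OF linear_induced2] linear_scale[OF assms(1)]
        linear_scale[OF linear_induced2] assms(2) induced2_wedge11)
  then show ?thesis
    using ext2_eq_sum_wedge11[OF assms(3)] by simp
qed


subsection \<open>The symplectic structure of $R^4$\<close>

definition symp_J :: "real ^ 4 ^ 4" where
  "symp_J = vector [vector [0, 0, -1,  0],
                    vector [0, 0,  0, -1],
                    vector [1, 0,  0,  0],
                    vector [0, 1,  0,  0]]"

definition symp_form :: "real ^ 4 ^ 4" where
  "symp_form = axis 1 1 \<and>\<^sub>1 axis 3 1 + axis 2 1 \<and>\<^sub>1 axis 4 1"

end

theory Submission
  imports
    Defs
    "HOL-Computational_Algebra.Fundamental_Theorem_Algebra"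
begin

text \<open>
  Both decay laws are instances of one fact: on \<open>R\<^sup>4\<close> the induced map is a derivation of the
  wedge product into the line of alternating 4-tensors, on which \<open>A\<close> acts as its trace
  (\<open>wedge22_induced2_derivation\<close>):
  \<open>A\<^sup>(\<^sup>2\<^sup>) U \<and> V + U \<and> A\<^sup>(\<^sup>2\<^sup>) V = (trace A) (U \<and> V)\<close>. For \<open>A = J\<^sup>-\<^sup>1 B\<close> with \<open>B\<close> symmetric,
  \<open>A\<^sup>(\<^sup>2\<^sup>) \<omega> = 0\<close>; this is the infinitesimal form of preserving \<open>\<omega>\<close>. Taking \<open>U = V = \<omega>\<close> in the
  identity gives \<open>trace A = 0\<close>, because \<open>\<omega> \<and> \<omega> \<noteq> 0\<close>. Hence along a solution the terms with \<open>A\<close>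
  cancel from the derivatives of \<open>U \<and> U\<close> and \<open>\<omega> \<and> U\<close>, and only the shift by \<open>\<sigma>\<close> survives, twice
  in the first and once in the second. The resulting linear equations with constant
  coefficient are solved by \<open>has_vector_derivative_growth_unique\<close>.

  The condition \<open>A\<^sup>(\<^sup>2\<^sup>) \<omega> = 0\<close> is linear in \<open>A\<close>, so it passes to the limit \<open>A_inf\<close>. Therefore the
  spectrum of \<open>A_inf\<close> is invariant under negation (\<open>uminus_in_eigenvalues\<close>), and if no eigenvalue
  is purely imaginary then one of them lies in the right half-plane. Since \<open>A_inf\<close> is real, its
  multiset of eigenvalues is invariant under conjugation (\<open>image_cnj_eigenvalues\<close>), which makes
  the sum over the right half-plane real.
\<close>

section \<open>The linear growth equation\<close>

lemma has_vector_derivative_growth_unique: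
  fixes f :: "real \<Rightarrow> 'a::real_normed_vector"
  assumes deriv: "\<And>x. x \<in> {a..b} \<Longrightarrow> (f has_vector_derivative c *\<^sub>R f x) (at x within {a..b})"
    and x: "x \<in> {a..b}"
  shows "f x = exp (c * (x - a)) *\<^sub>R f a"
proof -
  define g where "g y = exp (- c * (y - a)) *\<^sub>R f y" for y
  have "(g has_vector_derivative 0) (at y within {a..b})" if "y \<in> {a..b}" for y
    unfolding g_def
    by (auto intro!: derivative_eq_intros deriv[OF that])
  from has_vector_derivative_zero_constant[OF _ this] obtain d
    where d: "\<And>y. y \<in> {a..b} \<Longrightarrow> g y = d"
    by (metis convex_real_interval(5))
  have "g x = g a"
    using d[of x] d[of a] x by simp
  then have "exp (c * (x - a)) *\<^sub>R g x = exp (c * (x - a)) *\<^sub>R f a"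
    by (simp add: g_def)
  then show ?thesis
    by (simp add: g_def flip: exp_add)
qed

section \<open>Matrix algebra\<close>

lemma vector_4:
  "(vector [a, b, c, d] :: 'a::zero ^ 4) $ 1 = a" "(vector [a, b, c, d] :: 'a ^ 4) $ 2 = b"
  "(vector [a, b, c, d] :: 'a ^ 4) $ 3 = c" "(vector [a, b, c, d] :: 'a ^ 4) $ 4 = d"
  unfolding vector_def by simp_all

lemma matrix_mul_uminus:
  fixes A :: "'a::comm_ring_1 ^ 'n ^ 'm"
  shows "(- A) ** B = - (A ** B)" "A ** (- B) = - (A ** B)"
  by (simp_all add: vec_eq_iff matrix_matrix_mult_def sum_negf)

lemma matrix_diff_rdistrib:
  fixes A B :: "'a::comm_ring_1 ^ 'n ^ 'm"
  shows "(A - B) ** C = A ** C - B ** C"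
  by (simp add: vec_eq_iff matrix_matrix_mult_def left_diff_distrib sum_subtractf)

lemma mat_mul_eq:
  fixes A :: "'a::comm_ring_1 ^ 'n ^ 'n"
  shows "mat c ** A = (\<chi> i j. c * A $ i $ j)" "A ** mat c = (\<chi> i j. c * A $ i $ j)"
  by (simp_all add: vec_eq_iff matrix_matrix_mult_def mat_def mult.commute if_distrib
      if_distribR cong: if_cong)

section \<open>The exterior algebra of $R^4$\<close>

lemma ext2_uminus_swap: "U \<in> ext2 \<Longrightarrow> U $ i $ j = - U $ j $ i"
  unfolding ext2_def by blast

lemma bilinear_wedge22: "bilinear (\<and>\<^sub>2)"
  by (auto simp: bilinear_def vec_eq_iff wedge22_def algebra_simps intro!: linearI)

lemma induced2_eq:
  assumes "U \<in> ext2"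
  shows "induced2 A U = A ** U + U ** transpose A"
proof (rule induced2_unique[OF _ _ assms])
  show "linear (\<lambda>U. A ** U + U ** transpose A)"
    by (rule linearI)
       (simp_all add: matrix_matrix_mult_def vec_eq_iff sum.distrib sum_distrib_left algebra_simps)
  show "A ** (u \<and>\<^sub>1 v) + (u \<and>\<^sub>1 v) ** transpose A = (A *v u) \<and>\<^sub>1 v + u \<and>\<^sub>1 (A *v v)" for u v
    by (simp add: matrix_matrix_mult_def matrix_vector_mult_def transpose_def wedge11_def
        vec_eq_iff sum_subtractf sum_distrib_left sum_distrib_right algebra_simps)
qed

lemma induced2_in_ext2:
  assumes "U \<in> ext2"
  shows "induced2 A U \<in> ext2"
proof -
  have "(\<Sum>k\<in>UNIV. A $ i $ k * U $ k $ j) = - (\<Sum>k\<in>UNIV. U $ j $ k * A $ i $ k)" for i j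
    unfolding sum_negf[symmetric]
    by (rule sum.cong) (simp_all add: ext2_uminus_swap[OF assms, of k j for k])
  then show ?thesis
    unfolding induced2_eq[OF assms] ext2_def
    by (simp add: matrix_matrix_mult_def transpose_def)
qed

text \<open>
  The instances of antisymmetry that leave only the entries above the diagonal; oriented this
  way they are terminating rewrite rules.
\<close>

lemma ext2_4_entries:
  fixes U :: "real ^ 4 ^ 4"
  assumes "U \<in> ext2"
  shows "U $ i $ i = 0" "U $ 2 $ 1 = - U $ 1 $ 2" "U $ 3 $ 1 = - U $ 1 $ 3"
    "U $ 4 $ 1 = - U $ 1 $ 4" "U $ 3 $ 2 = - U $ 2 $ 3" "U $ 4 $ 2 = - U $ 2 $ 4"
    "U $ 4 $ 3 = - U $ 3 $ 4"
proof -
  show "U $ i $ i = 0"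
    using ext2_uminus_swap[OF assms, of i i] by simp
qed (rule ext2_uminus_swap[OF assms])+

text \<open>
  The alternating 4-tensors on \<open>R\<^sup>4\<close> form a line, so an identity between products of bivectors
  needs to be checked in a single coordinate.
\<close>

lemma wedge22_eq_volume:
  fixes U V :: "real ^ 4 ^ 4"
  assumes "U \<in> ext2" "V \<in> ext2"
  shows "U \<and>\<^sub>2 V = (U \<and>\<^sub>2 V) $ 1 $ 2 $ 3 $ 4 *\<^sub>R
           ((axis 1 1 \<and>\<^sub>1 axis 2 1) \<and>\<^sub>2 (axis 3 1 \<and>\<^sub>1 axis 4 1))"
  unfolding vec_eq_iff forall_4
  by (simp add: wedge22_def wedge11_def axis_def ext2_4_entries[OF assms(1)] ext2_4_entries[OF assms(2)])

text \<open>
  A matrix acts on the top exterior power as its trace, the infinitesimal counterpart of the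
  determinant. By the previous lemma this is a polynomial identity in the entries of \<open>A\<close> and
  the six coordinates of \<open>U\<close> and of \<open>V\<close>.
\<close>

lemma wedge22_induced2_derivation:
  fixes U V :: "real ^ 4 ^ 4"
  assumes U: "U \<in> ext2" and V: "V \<in> ext2"
  shows "induced2 A U \<and>\<^sub>2 V + U \<and>\<^sub>2 induced2 A V = trace A *\<^sub>R (U \<and>\<^sub>2 V)"
proof -
  have entry: "induced2 A W $ i $ j = (\<Sum>k\<in>UNIV. A $ i $ k * W $ k $ j + W $ i $ k * A $ j $ k)"
    if "W \<in> ext2" for W i j
    by (simp add: induced2_eq[OF that] matrix_matrix_mult_def transpose_def sum.distrib)
  have "(induced2 A U \<and>\<^sub>2 V) $ 1 $ 2 $ 3 $ 4 + (U \<and>\<^sub>2 induced2 A V) $ 1 $ 2 $ 3 $ 4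
      = trace A * (U \<and>\<^sub>2 V) $ 1 $ 2 $ 3 $ 4"
    unfolding wedge22_def vec_lambda_beta entry[OF U] entry[OF V] sum_4 trace_def
      ext2_4_entries[OF U] ext2_4_entries[OF V]
    by algebra
  moreover have "induced2 A U \<and>\<^sub>2 V + U \<and>\<^sub>2 induced2 A V
      = ((induced2 A U \<and>\<^sub>2 V) $ 1 $ 2 $ 3 $ 4 + (U \<and>\<^sub>2 induced2 A V) $ 1 $ 2 $ 3 $ 4) *\<^sub>R
        ((axis 1 1 \<and>\<^sub>1 axis 2 1) \<and>\<^sub>2 (axis 3 1 \<and>\<^sub>1 axis 4 1))"
    unfolding scaleR_add_left wedge22_eq_volume[OF induced2_in_ext2[OF U] V, symmetric]
      wedge22_eq_volume[OF U induced2_in_ext2[OF V], symmetric] ..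
  moreover have "trace A *\<^sub>R (U \<and>\<^sub>2 V) = (trace A * (U \<and>\<^sub>2 V) $ 1 $ 2 $ 3 $ 4) *\<^sub>R
        ((axis 1 1 \<and>\<^sub>1 axis 2 1) \<and>\<^sub>2 (axis 3 1 \<and>\<^sub>1 axis 4 1))"
    unfolding scaleR_scaleR[symmetric] wedge22_eq_volume[OF U V, symmetric] ..
  ultimately show ?thesis
    by (simp only:)
qed

section \<open>Hamiltonian matrices\<close>

lemma symp_form_in_ext2: "symp_form \<in> ext2"
  by (simp add: symp_form_def ext2_def wedge11_def)

lemma symp_form_eq_uminus_J: "symp_form = - symp_J"
  by (simp add: symp_form_def symp_J_def wedge11_def vec_eq_iff forall_4 axis_def vector_4)

lemma symp_form_square: "symp_form ** symp_form = - mat 1"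
  by (simp add: symp_form_eq_uminus_J symp_J_def vec_eq_iff forall_4 matrix_matrix_mult_def
      sum_4 mat_def vector_4)

lemma matrix_inv_symp_J: "matrix_inv symp_J = symp_form"
proof -
  have inverse: "symp_J ** symp_form = mat 1" "symp_form ** symp_J = mat 1"
    by (simp_all add: symp_form_eq_uminus_J symp_J_def vec_eq_iff forall_4 matrix_matrix_mult_def
        sum_4 mat_def vector_4)
  then have "symp_J ** matrix_inv symp_J = mat 1 \<and> matrix_inv symp_J ** symp_J = mat 1"
    unfolding matrix_inv_def by (intro someI) blast
  with inverse show ?thesis
    by (metis matrix_mul_assoc matrix_mul_lid matrix_mul_rid)
qed

lemma transpose_symp_form: "transpose symp_form = - symp_form"
  by (simp add: symp_form_def wedge11_def vec_eq_iff transpose_def)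

text \<open>
  As a matrix \<open>\<omega>\<close> equals \<open>J\<^sup>-\<^sup>1\<close>, so \<open>A = \<omega> S\<close> below is \<open>J\<^sup>-\<^sup>1 S\<close>. The condition
  \<open>A\<^sup>(\<^sup>2\<^sup>) \<omega> = A \<omega> + \<omega> A\<^sup>T = 0\<close> is the form in which the Hamiltonian structure is used from here
  on: it is linear in \<open>A\<close> and makes no mention of \<open>S\<close>.
\<close>

lemma induced2_symp_form_eq_0:
  assumes "transpose S = S"
  shows "induced2 (symp_form ** S) symp_form = 0"
  unfolding induced2_eq[OF symp_form_in_ext2]
  by (simp add: matrix_transpose_mul assms transpose_symp_form matrix_mul_assoc matrix_mul_uminus)

lemma trace_eq_0_if_induced2_symp_form_eq_0:
  assumes "induced2 A symp_form = 0"
  shows "trace A = 0"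
proof -
  have "trace A *\<^sub>R (symp_form \<and>\<^sub>2 symp_form) = 0"
    unfolding wedge22_induced2_derivation[OF symp_form_in_ext2 symp_form_in_ext2, symmetric]
    by (simp add: assms bilinear_lzero[OF bilinear_wedge22] bilinear_rzero[OF bilinear_wedge22])
  moreover have "(symp_form \<and>\<^sub>2 symp_form) $ 1 $ 2 $ 3 $ 4 \<noteq> 0"
    by (simp add: wedge22_def wedge11_def symp_form_def axis_def)
  ultimately show ?thesis
    by (metis scaleR_eq_0_iff zero_index)
qed

section \<open>Eigenvalues\<close>

definition complexify :: "real ^ 'n ^ 'm \<Rightarrow> complex ^ 'n ^ 'm" where
  "complexify M = (\<chi> i j. complex_of_real (M $ i $ j))"

lemma eigenvalues_eq_proots: "eigenvalues M = proots (charpoly (complexify M))"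
  by (simp add: eigenvalues_def complexify_def)

lemma complexify_simps:
  "complexify (A ** B) = complexify A ** complexify B"
  "complexify (- M) = - complexify M"
  "complexify (transpose M) = transpose (complexify M)"
  "complexify (mat c) = mat (complex_of_real c)"
  by (simp_all add: complexify_def vec_eq_iff matrix_matrix_mult_def transpose_def mat_def)

lemma cnj_prod_mset: "cnj (\<Prod>x\<in>#Q. f x) = (\<Prod>x\<in>#Q. cnj (f x))"
  by (induction Q) auto

text \<open>
  Read off from the factorization into linear factors, which takes care of multiplicities.
\<close>

lemma proots_map_poly_cnj: "proots (map_poly cnj p) = image_mset cnj (proots p)"
proof (cases "p = 0")
  case False
  have "map_poly cnj p = smult (cnj (lead_coeff p)) (\<Prod>z\<in>#proots p. [:- cnj z, 1:])"
  proof (subst poly_eq_poly_eq_iff[symmetric], rule ext)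
    fix x
    have "poly (map_poly cnj p) x = cnj (poly p (cnj x))"
      by simp
    also have "poly p (cnj x) = lead_coeff p * (\<Prod>z\<in>#proots p. cnj x - z)"
      by (subst complex_poly_decompose_multiset[of p, symmetric]) (simp add: poly_prod_mset image_mset.compositionality o_def)
    also have "cnj \<dots> = cnj (lead_coeff p) * (\<Prod>z\<in>#proots p. x - cnj z)"
      by (simp add: cnj_prod_mset)
    also have "\<dots> = poly (smult (cnj (lead_coeff p)) (\<Prod>z\<in>#proots p. [:- cnj z, 1:])) x"
      by (simp add: poly_prod_mset image_mset.compositionality o_def)
    finally show "poly (map_poly cnj p) x = \<dots>" .
  qed
  moreover have "proots (\<Prod>z\<in>#Q. [:- cnj z, 1:]) = image_mset cnj Q" for Q
  proof (induction Q)
    case (add z Q)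
    have "(\<Prod>z\<in>#Q. [:- cnj z, 1:]) \<noteq> 0"
      by (auto simp: prod_mset_zero_iff)
    then have "proots ([:- cnj z, 1:] * (\<Prod>z\<in>#Q. [:- cnj z, 1:]))
        = {#cnj z#} + proots (\<Prod>z\<in>#Q. [:- cnj z, 1:])"
      by (subst proots_mult) simp_all
    with add.IH show ?case
      by (simp del: mult_pCons_left)
  qed simp
  ultimately show ?thesis
    using False by simp
qed simp

lemma image_cnj_eigenvalues: "image_mset cnj (eigenvalues M) = eigenvalues M"
proof -
  have "cnj (det (mat (cnj z) - complexify M)) = det (mat z - complexify M)" for z
    unfolding det_def by (auto simp: mat_def complexify_def intro!: sum.cong prod.cong)
  then have "map_poly cnj (charpoly (complexify M)) = charpoly (complexify M)"
    by (subst poly_eq_poly_eq_iff[symmetric]) (simp add: fun_eq_iff poly_charpoly)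
  then show ?thesis
    by (metis eigenvalues_eq_proots proots_map_poly_cnj)
qed

lemma cnj_sum_mset: "cnj (\<Sum>\<^sub># Q) = \<Sum>\<^sub># (image_mset cnj Q)"
  by (induction Q) auto

lemma sigma_plus_real: "sigma_plus M \<in> \<real>"
proof -
  have "cnj (sigma_plus M) = (\<Sum>\<^sub># {# z \<in># image_mset cnj (eigenvalues M). 0 < Re z #})"
    unfolding sigma_plus_def by (simp add: filter_mset_image_mset cnj_sum_mset)
  then show ?thesis
    unfolding image_cnj_eigenvalues by (simp add: sigma_plus_def Reals_cnj_iff)
qed

text \<open>
  If \<open>det (z I - M)\<close> had the constant value \<open>c\<close>, then \<open>det (I - w M) = w\<^sup>n c\<close> for \<open>w = 1 / z\<close>, and
  letting \<open>w\<close> tend to \<open>0\<close> would give \<open>det I = 0\<close>. This avoids computing the leading coefficient.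
\<close>

lemma degree_charpoly_pos:
  fixes M :: "complex ^ 'n ^ 'n"
  shows "0 < degree (charpoly M)"
proof (rule ccontr)
  assume "\<not> 0 < degree (charpoly M)"
  then obtain c where c: "charpoly M = [:c:]"
    using degree_eq_zeroE by blast
  have *: "det (mat 1 - (\<chi> i j. w * M $ i $ j)) = w ^ CARD('n) * c" if "w \<noteq> 0" for w
  proof -
    have "mat 1 - (\<chi> i j. w * M $ i $ j) = mat w ** (mat (1 / w) - M)"
      using that by (simp add: mat_mul_eq, simp add: vec_eq_iff mat_def right_diff_distrib)
    moreover have "det (mat (1 / w) - M) = c"
      using poly_charpoly[of M "1 / w"] by (simp add: c)
    moreover have "det (mat w :: complex ^ 'n ^ 'n) = w ^ CARD('n)"
      by (subst det_diagonal) (simp_all add: mat_def)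
    ultimately show ?thesis
      by (simp add: det_mul)
  qed
  have "((\<lambda>w. det (mat 1 - (\<chi> i j. w * M $ i $ j))) \<longlongrightarrow> det (mat 1 - (\<chi> i j. 0 * M $ i $ j))) (at 0)"
    unfolding det_def by (simp only: vector_minus_component vec_lambda_beta) (intro tendsto_intros)
  moreover have "((\<lambda>w. w ^ CARD('n) * c) \<longlongrightarrow> 0 ^ CARD('n) * c) (at 0)"
    by (intro tendsto_intros)
  then have "((\<lambda>w. det (mat 1 - (\<chi> i j. w * M $ i $ j))) \<longlongrightarrow> 0 ^ CARD('n) * c) (at 0)"
    by (rule Lim_transform_eventually) (auto simp: eventually_at_filter *)
  moreover have "0 ^ CARD('n) * c = 0"
    by (simp add: zero_power)
  ultimately have "det (mat 1 - (\<chi> i j. 0 * M $ i $ j) :: complex ^ 'n ^ 'n) = 0"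
    using tendsto_unique[OF at_neq_bot] by metis
  moreover have "mat 1 - (\<chi> i j. 0 * M $ i $ j) = (mat 1 :: complex ^ 'n ^ 'n)"
    by (simp add: vec_eq_iff)
  ultimately show False by simp
qed

lemma in_eigenvalues_iff: "z \<in># eigenvalues M \<longleftrightarrow> det (mat z - complexify M) = 0"
proof -
  have "charpoly (complexify M) \<noteq> 0"
    using degree_charpoly_pos[of "complexify M"] by auto
  then show ?thesis
    by (simp add: eigenvalues_eq_proots poly_charpoly)
qed

lemma eigenvalues_nonempty: "eigenvalues M \<noteq> {#}"
  using degree_charpoly_pos[of "complexify M"]
  by (metis eigenvalues_eq_proots size_proots_complex size_empty less_irrefl)

text \<open>
  Up to sign, conjugation by \<open>\<omega>\<close> turns \<open>A\<close> into its transpose, so that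
  \<open>\<omega> (z I - A) \<omega> = - z I - A\<^sup>T\<close>, and a matrix has the same determinant as its transpose.
\<close>

lemma uminus_in_eigenvalues:
  fixes A :: "real ^ 4 ^ 4"
  assumes "induced2 A symp_form = 0" and "z \<in># eigenvalues A"
  shows "- z \<in># eigenvalues A"
proof -
  define W where "W = complexify symp_form"
  define M where "M = complexify A"
  have "A ** symp_form = - (symp_form ** transpose A)"
    using assms(1) by (simp add: induced2_eq[OF symp_form_in_ext2] add_eq_0_iff2)
  then have MW: "M ** W = - (W ** transpose M)"
    by (metis M_def W_def complexify_simps(1-3))
  have WW: "W ** W = - mat 1"
    by (metis W_def complexify_simps symp_form_square of_real_1)
  have "W ** ((mat z - M) ** W) = mat (- z) - transpose M"
  proof -
    have "(mat z - M) ** W = mat z ** W - M ** W"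
      by (rule matrix_diff_rdistrib)
    also have "\<dots> = W ** (mat z + transpose M)"
      by (simp add: MW matrix_add_ldistrib mat_mul_eq)
    finally have "W ** ((mat z - M) ** W) = - (mat z + transpose M)"
      by (simp add: matrix_mul_assoc WW matrix_mul_uminus)
    then show ?thesis
      by (simp add: vec_eq_iff mat_def)
  qed
  moreover have "det (mat z - M) = 0"
    using assms(2) by (simp add: in_eigenvalues_iff M_def)
  ultimately have "det (mat (- z) - transpose M) = 0"
    by (metis det_mul mult_zero_left mult_zero_right)
  moreover have "mat (- z) - transpose M = transpose (mat (- z) - M)"
    by (simp add: vec_eq_iff transpose_def mat_def)
  ultimately show ?thesis
    by (simp add: in_eigenvalues_iff M_def det_transpose)
qed

lemma Re_sigma_plus_pos:
  assumes "induced2 A symp_form = 0" and "\<And>z. z \<in># eigenvalues A \<Longrightarrow> Re z \<noteq> 0"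
  shows "0 < Re (sigma_plus A)"
proof -
  obtain z where "z \<in># eigenvalues A"
    using eigenvalues_nonempty by blast
  then obtain w where w: "w \<in># eigenvalues A" "0 < Re w"
    using uminus_in_eigenvalues[OF assms(1)] assms(2)
    by (metis linorder_neqE_linordered_idom neg_0_less_iff_less uminus_complex.simps(1))
  define P where "P = {# z \<in># eigenvalues A. 0 < Re z #}"
  have pos: "0 \<le> Re (\<Sum>\<^sub># Q)" if "\<And>z. z \<in># Q \<Longrightarrow> 0 < Re z" for Q
    using that by (induction Q) (auto intro!: add_nonneg_nonneg less_imp_le simp: less_imp_le)
  have "w \<in># P"
    using w by (simp add: P_def)
  then obtain Q where Q: "P = add_mset w Q"
    by (rule mset_add)
  have "0 < Re z" if "z \<in># Q" for z
    using that Q by (metis P_def filter_mset_eq_conv union_single_eq_member add_mset_eq_single insert_iff set_mset_add_mset_insert)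
  then have "0 < Re (\<Sum>\<^sub># P)"
    using pos[of Q] w by (simp add: Q add_pos_nonneg)
  then show ?thesis
    by (simp add: sigma_plus_def P_def)
qed

theorem mainTheorem2:
  fixes A B :: "real \<Rightarrow> real \<Rightarrow> real ^ 4 ^ 4"
    and A_inf :: "real \<Rightarrow> real ^ 4 ^ 4"
    and lam :: real
  assumes B_smooth: "smooth (\<lambda>(x, l). B x l)"
    and B_symmetric: "\<And>x l. transpose (B x l) = B x l"
    and A_eq: "\<And>x l. A x l = matrix_inv symp_J ** B x l"
    and A_lim_top: "\<And>l. ((\<lambda>x. A x l) \<longlongrightarrow> A_inf l) at_top"
    and A_lim_bot: "\<And>l. ((\<lambda>x. A x l) \<longlongrightarrow> A_inf l) at_bot"
    and hyperbolic: "\<And>z. z \<in># eigenvalues (A_inf lam) \<Longrightarrow> Re z \<noteq> 0"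
  shows "\<exists>\<sigma>::real. sigma_plus (A_inf lam) = complex_of_real \<sigma> \<and> 0 < \<sigma> \<and>
    (\<forall>(L::real) (U :: real \<Rightarrow> real ^ 4 ^ 4).
       0 < L \<longrightarrow>
       (\<forall>x\<in>{-L..L}. U x \<in> ext2) \<longrightarrow>
       (\<forall>x\<in>{-L..L}. (U has_vector_derivative
          (induced2 (A x lam) (U x) - \<sigma> *\<^sub>R U x)) (at x within {-L..L})) \<longrightarrow>
       (\<forall>x\<in>{-L..L}.
          U x \<and>\<^sub>2 U x = exp (- 2 * \<sigma> * (x + L)) *\<^sub>R (U (-L) \<and>\<^sub>2 U (-L)) \<and>
          symp_form \<and>\<^sub>2 U x = exp (- \<sigma> * (x + L)) *\<^sub>R (symp_form \<and>\<^sub>2 U (-L))))"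
proof -
  have ham: "induced2 (A x lam) symp_form = 0" for x
    by (simp add: A_eq matrix_inv_symp_J induced2_symp_form_eq_0 B_symmetric)
  have ham_inf: "induced2 (A_inf lam) symp_form = 0"
  proof -
    have "bounded_linear (\<lambda>M. induced2 M symp_form)"
      unfolding linear_conv_bounded_linear[symmetric] induced2_eq[OF symp_form_in_ext2]
      by (rule linearI) (simp_all add: matrix_matrix_mult_def vec_eq_iff transpose_def
          sum.distrib sum_distrib_left algebra_simps)
    from bounded_linear.tendsto[OF this A_lim_top[of lam]]
    show ?thesis
      by (simp add: ham tendsto_const_iff)
  qed
  define \<sigma> where "\<sigma> = Re (sigma_plus (A_inf lam))"
  have "sigma_plus (A_inf lam) = complex_of_real \<sigma>"
    using sigma_plus_real[of "A_inf lam"] by (simp add: \<sigma>_def)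
  moreover have "0 < \<sigma>"
    unfolding \<sigma>_def by (rule Re_sigma_plus_pos[OF ham_inf hyperbolic])
  moreover have "U x \<and>\<^sub>2 U x = exp (- 2 * \<sigma> * (x + L)) *\<^sub>R (U (-L) \<and>\<^sub>2 U (-L)) \<and>
      symp_form \<and>\<^sub>2 U x = exp (- \<sigma> * (x + L)) *\<^sub>R (symp_form \<and>\<^sub>2 U (-L))"
    if ext: "\<forall>x\<in>{-L..L}. U x \<in> ext2"
      and ode: "\<forall>x\<in>{-L..L}. (U has_vector_derivative
          (induced2 (A x lam) (U x) - \<sigma> *\<^sub>R U x)) (at x within {-L..L})"
      and x: "x \<in> {-L..L}" for L U x
  proof -
    have bb: "bounded_bilinear ((\<and>\<^sub>2) :: real^4^4 \<Rightarrow> real^4^4 \<Rightarrow> real^4^4^4^4)"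
      using bilinear_wedge22 bilinear_conv_bounded_bilinear by blast
    note bl = bilinear_lsub[OF bilinear_wedge22] bilinear_rsub[OF bilinear_wedge22]
      bilinear_lmul[OF bilinear_wedge22] bilinear_rmul[OF bilinear_wedge22]
      bilinear_lzero[OF bilinear_wedge22]
    have tr: "trace (A y lam) = 0" for y
      by (rule trace_eq_0_if_induced2_symp_form_eq_0[OF ham])
    have "((\<lambda>y. U y \<and>\<^sub>2 U y) has_vector_derivative (- 2 * \<sigma>) *\<^sub>R (U y \<and>\<^sub>2 U y))
        (at y within {-L..L})" if y: "y \<in> {-L..L}" for y
    proof -
      let ?D = "induced2 (A y lam) (U y)"
      have "?D \<and>\<^sub>2 U y + U y \<and>\<^sub>2 ?D = 0"
        using wedge22_induced2_derivation[of "U y" "U y" "A y lam"] ext y tr by simp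
      moreover have "U y \<and>\<^sub>2 (?D - \<sigma> *\<^sub>R U y) + (?D - \<sigma> *\<^sub>R U y) \<and>\<^sub>2 U y
          = ?D \<and>\<^sub>2 U y + U y \<and>\<^sub>2 ?D - (\<sigma> + \<sigma>) *\<^sub>R (U y \<and>\<^sub>2 U y)"
        unfolding bl scaleR_add_left by simp
      ultimately have "U y \<and>\<^sub>2 (?D - \<sigma> *\<^sub>R U y) + (?D - \<sigma> *\<^sub>R U y) \<and>\<^sub>2 U y
          = (- 2 * \<sigma>) *\<^sub>R (U y \<and>\<^sub>2 U y)"
        by simp
      with bounded_bilinear.has_vector_derivative[OF bb ode[rule_format, OF y] ode[rule_format, OF y]]
      show ?thesis by simp
    qed
    from has_vector_derivative_growth_unique[OF this x]
    have 1: "U x \<and>\<^sub>2 U x = exp (- 2 * \<sigma> * (x + L)) *\<^sub>R (U (-L) \<and>\<^sub>2 U (-L))"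
      by simp
    have "((\<lambda>y. symp_form \<and>\<^sub>2 U y) has_vector_derivative (- \<sigma>) *\<^sub>R (symp_form \<and>\<^sub>2 U y))
        (at y within {-L..L})" if y: "y \<in> {-L..L}" for y
    proof -
      let ?D = "induced2 (A y lam) (U y)"
      have "symp_form \<and>\<^sub>2 ?D = 0"
        using wedge22_induced2_derivation[of symp_form "U y" "A y lam"] ext y tr ham
        by (simp add: symp_form_in_ext2 bl)
      then have "symp_form \<and>\<^sub>2 (?D - \<sigma> *\<^sub>R U y) = (- \<sigma>) *\<^sub>R (symp_form \<and>\<^sub>2 U y)"
        by (simp add: bl)
      with bounded_bilinear.has_vector_derivative[OF bb has_vector_derivative_const[of symp_form]
          ode[rule_format, OF y]]
      show ?thesis by (simp add: bl)
    qed
    from has_vector_derivative_growth_unique[OF this x] 1 show ?thesis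
      by simp
  qed
  ultimately show ?thesis
    by blast
qed

end
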